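(* Let $n \ge r \ge 1$ be integers and let $\mathcal{K}_n^r=(V,E)$ be the complete $r$-uniform hypergraph on $n$ vertices, i.e. $|V|=n$ and $E$ is the set of all $r$-element subsets of $V$. Let $k=\lceil n/2\rceil$. Then for every function $f:E\to\{-1,1\}$ with $\sum_{A\in E} f(A)=0$, \[ X(f)=\min_{v\in V}\Big|\sum_{A\in E,\,A\ni v} f(A)\Big| \;\le\; \frac{\sum_{\ell=0}^r \big|\lceil r/2\rceil-\ell\big|\binom{n-k}{\ell}\binom{k}{r-\ell}}{k}. \] Equivalently, $X(\mathcal{K}_n^r)$ is at most this quantity.
   Context: For a hypergraph $\mathcal{H}=(V,E)$ and $f:E\to\{-1,1\}$, the unbalancedness is $X(f)=\min_{v\in V}|\sum_{A\ni v} f(A)|$, and $X(\mathcal{H})$ denotes the maximum of $X(f)$ over all $f:E\to\{-1,1\}$ with $\sum_{A\in E} f(A)=0$. Binomial coefficients $\binom{a}{b}$ are $0$ when $b<0$ or $b>a$. *)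

theory Defs
  imports Complex_Main "HOL-Library.FuncSet"
begin

text \<open>
  A finite hypergraph is given by its vertex set \<open>V\<close> and its edge set \<open>E\<close>.
\<close>

definition complete_uniform_edges :: "'a set \<Rightarrow> nat \<Rightarrow> 'a set set" where
  "complete_uniform_edges V r = {A. A \<subseteq> V \<and> card A = r}"

definition unbalancedness :: "'a set \<Rightarrow> 'a set set \<Rightarrow> ('a set \<Rightarrow> int) \<Rightarrow> int" where
  "unbalancedness V E f = Min ((\<lambda>v. \<bar>\<Sum>A\<in>{A \<in> E. v \<in> A}. f A\<bar>) ` V)"

text \<open>
  The extensional function space makes the set of signings of a finite edge set finite.
\<close>

definition balanced_signings :: "'a set set \<Rightarrow> ('a set \<Rightarrow> int) set" where
  "balanced_signings E = {f \<in> E \<rightarrow>\<^sub>E {-1, 1}. (\<Sum>A\<in>E. f A) = 0}"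

text \<open>
  If \<open>E\<close> has an odd number of edges there are no balanced signings, and the maximum below is
  over the empty set, hence unspecified.
\<close>

definition hypergraph_unbalancedness :: "'a set \<Rightarrow> 'a set set \<Rightarrow> int" where
  "hypergraph_unbalancedness V E = Max (unbalancedness V E ` balanced_signings E)"

end

theory Submission
  imports Defs
begin

text \<open>
  Write \<open>d v\<close> for the signed degree of \<open>v\<close>. Since \<open>2k \<le> n + 1\<close>, some \<open>k\<close> vertices have
  signed degrees of the same weak sign; let \<open>T\<close> consist of them. Then \<open>k X(f)\<close> is at most
  \<open>\<bar>\<Sum>v\<in>T. d v\<bar> = \<bar>\<Sum>A. f A * card (A \<inter> T)\<bar>\<close>, and as \<open>f\<close> has total sum zero any constant may be
  subtracted from \<open>card (A \<inter> T)\<close> before estimating termwise. The constant \<open>r - \<lceil>r/2\<rceil>\<close> gives the bound.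
\<close>

text \<open>Double counting of the pairs of a vertex in \<open>T\<close> and an edge through it: an
  edge \<open>A\<close> occurs once for each vertex that it shares with \<open>T\<close>.\<close>

lemma sum_signed_degrees:
  fixes f :: "'a set \<Rightarrow> int"
  assumes "finite E" "finite T"
  shows "(\<Sum>v\<in>T. \<Sum>A\<in>{A \<in> E. v \<in> A}. f A) = (\<Sum>A\<in>E. f A * int (card (A \<inter> T)))"
proof -
  have "(\<Sum>v\<in>T. \<Sum>A\<in>{A \<in> E. v \<in> A}. f A) = (\<Sum>A\<in>E. \<Sum>v\<in>{v \<in> T. v \<in> A}. f A)"
    by (rule sum.swap_restrict[OF assms(2,1)])
  also have "\<dots> = (\<Sum>A\<in>E. f A * int (card (A \<inter> T)))"
    by (intro sum.cong refl) (simp add: Collect_conj_eq Int_commute mult.commute)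
  finally show ?thesis .
qed

lemma abs_sum_signed_degrees_le:
  fixes f :: "'a set \<Rightarrow> int" and c :: int
  assumes "finite E" "finite T" "f \<in> E \<rightarrow> {-1, 1}" "(\<Sum>A\<in>E. f A) = 0"
  shows "\<bar>\<Sum>v\<in>T. \<Sum>A\<in>{A \<in> E. v \<in> A}. f A\<bar> \<le> (\<Sum>A\<in>E. \<bar>int (card (A \<inter> T)) - c\<bar>)"
proof -
  have "(\<Sum>v\<in>T. \<Sum>A\<in>{A \<in> E. v \<in> A}. f A) = (\<Sum>A\<in>E. f A * (int (card (A \<inter> T)) - c))"
    using assms(4)
    by (simp add: sum_signed_degrees[OF assms(1,2)] right_diff_distrib sum_subtractf
        flip: sum_distrib_right)
  also have "\<bar>\<dots>\<bar> \<le> (\<Sum>A\<in>E. \<bar>f A * (int (card (A \<inter> T)) - c)\<bar>)"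
    by (rule sum_abs)
  also have "\<dots> = (\<Sum>A\<in>E. \<bar>int (card (A \<inter> T)) - c\<bar>)"
    using assms(3) by (intro sum.cong refl) (auto simp: Pi_iff abs_mult)
  finally show ?thesis .
qed

text \<open>A set is determined by its parts outside and inside \<open>T\<close>, and these can be
  chosen independently. With \<open>l \<le> r\<close> the natural number \<open>r - l\<close> is a
  true difference.\<close>

lemma card_subsets_with_split:
  assumes "finite V" "T \<subseteq> V" "l \<le> r"
  shows "card {A. A \<subseteq> V \<and> card A = r \<and> card (A - T) = l}
    = (card (V - T) choose l) * (card T choose (r - l))"
proof -
  let ?X = "{C. C \<subseteq> V - T \<and> card C = l}" and ?Y = "{D. D \<subseteq> T \<and> card D = r - l}"
  have fin: "finite T" "finite (V - T)"
    using assms finite_subset by auto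
  have "bij_betw (\<lambda>A. (A - T, A \<inter> T)) {A. A \<subseteq> V \<and> card A = r \<and> card (A - T) = l} (?X \<times> ?Y)"
  proof (rule bij_betw_byWitness[where f' = "\<lambda>(C, D). C \<union> D"])
    show "(\<lambda>A. (A - T, A \<inter> T)) ` {A. A \<subseteq> V \<and> card A = r \<and> card (A - T) = l} \<subseteq> ?X \<times> ?Y"
      \<comment> \<open>What remains is \<open>card (A \<inter> T) = r - l\<close>. As
        \<open>card (A \<inter> T) \<le> card A\<close>, the truncated difference
        \<open>card A - card (A \<inter> T) = l\<close> can be inverted.\<close>
      using fin by (auto simp: card_Diff_subset_Int)
        (metis assms(1) card_Diff_subset_Int card_mono diff_diff_cancel finite_Int finite_subset
          inf_le1)
    show "(\<lambda>(C, D). C \<union> D) ` (?X \<times> ?Y) \<subseteq> {A. A \<subseteq> V \<and> card A = r \<and> card (A - T) = l}"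
    proof clarify
      fix C D assume C: "C \<subseteq> V - T" "l = card C" and D: "D \<subseteq> T" "card D = r - card C"
      have "finite C" "finite D"
        using C(1) D(1) fin by (blast intro: finite_subset)+
      then have "card (C \<union> D) = card C + card D"
        using C(1) D(1) by (intro card_Un_disjoint) auto
      moreover have "C \<union> D - T = C"
        using C(1) D(1) by auto
      ultimately show "C \<union> D \<subseteq> V \<and> card (C \<union> D) = r \<and> card (C \<union> D - T) = card C"
        using C D assms by auto
    qed
  qed auto
  then show ?thesis
    using fin by (simp add: bij_betw_same_card card_cartesian_product n_subsets)
qed

text \<open>Edges are grouped by how many vertices they have outside \<open>T\<close>. Sizes that no
  edge attains may stay in the range, since their binomial coefficients vanish.\<close>

lemma sum_over_complete_uniform_edges:
  fixes g :: "nat \<Rightarrow> real"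
  assumes "finite V" "T \<subseteq> V"
  shows "(\<Sum>A\<in>complete_uniform_edges V r. g (card (A - T)))
    = (\<Sum>l=0..r. g l * real (card (V - T) choose l) * real (card T choose (r - l)))"
proof -
  let ?E = "complete_uniform_edges V r"
  have finE: "finite ?E"
    using assms(1) by (simp add: complete_uniform_edges_def)
  \<comment> \<open>This ensures that the groups for \<open>l = 0..r\<close> exhaust the
    edges.\<close>
  have "card (A - T) \<le> r" if "A \<in> ?E" for A
    using that assms(1) finite_subset card_mono[of A "A - T"]
    by (auto simp: complete_uniform_edges_def)
  then have "(\<Sum>A\<in>?E. g (card (A - T)))
      = (\<Sum>l=0..r. \<Sum>A\<in>{A \<in> ?E. card (A - T) = l}. g (card (A - T)))"
    by (intro sum.group[symmetric] finE) auto
  also have "\<dots> = (\<Sum>l=0..r. g l * real (card {A \<in> ?E. card (A - T) = l}))"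
    by (intro sum.cong refl) simp
  also have "\<dots> = (\<Sum>l=0..r. g l * real (card (V - T) choose l) * real (card T choose (r - l)))"
    using card_subsets_with_split[OF assms]
    by (intro sum.cong refl) (simp add: complete_uniform_edges_def conj_assoc)
  finally show ?thesis .
qed

text \<open>Pigeonhole: if both sign classes had at most \<open>k - 1\<close> elements, then
  \<open>card V \<le> 2 * k - 2\<close>, against the assumption. Within one class the values do not
  cancel, so the bounds \<open>X\<close> add up.\<close>

lemma exists_same_sign_subset:
  fixes d :: "'a \<Rightarrow> int"
  assumes "finite V" "2 * k \<le> card V + 1" "\<And>v. v \<in> V \<Longrightarrow> X \<le> \<bar>d v\<bar>"
  obtains T where "T \<subseteq> V" "card T = k" "int k * X \<le> \<bar>\<Sum>v\<in>T. d v\<bar>"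
proof -
  let ?P = "{v \<in> V. 0 \<le> d v}" and ?N = "{v \<in> V. d v < 0}"
  have "card ?P + card ?N = card (?P \<union> ?N)"
    using assms(1) by (intro card_Un_disjoint[symmetric]) auto
  moreover have "?P \<union> ?N = V" by auto
  ultimately consider "k \<le> card ?P" | "k \<le> card ?N"
    using assms(2) by fastforce
  then show thesis
  proof cases
    case 1
    then obtain T where T: "T \<subseteq> ?P" "card T = k"
      by (meson obtain_subset_with_card_n)
    have "X \<le> d v" if "v \<in> T" for v
      using T(1) assms(3)[of v] that by auto
    then have "int k * X \<le> (\<Sum>v\<in>T. d v)"
      using sum_bounded_below[of T X d] T(2) by simp
    then show thesis
      using T by (intro that[of T]) auto
  next
    case 2
    then obtain T where T: "T \<subseteq> ?N" "card T = k"
      by (meson obtain_subset_with_card_n)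
    have "d v \<le> - X" if "v \<in> T" for v
      using T(1) assms(3)[of v] that by auto
    then have "(\<Sum>v\<in>T. d v) \<le> int k * (- X)"
      using sum_bounded_above[of T d "- X"] T(2) by simp
    then show thesis
      using T by (intro that[of T]) auto
  qed
qed

lemma unbalancedness_complete_le:
  fixes V :: "'a set" and f :: "'a set \<Rightarrow> int"
  assumes "finite V" and "card V = n" and "1 \<le> n"
    and k: "k = nat \<lceil>real n / 2\<rceil>"
    and f: "f \<in> complete_uniform_edges V r \<rightarrow> {-1, 1}" "(\<Sum>A\<in>complete_uniform_edges V r. f A) = 0"
  shows "real_of_int (unbalancedness V (complete_uniform_edges V r) f)
    \<le> (\<Sum>l=0..r. \<bar>real_of_int \<lceil>real r / 2\<rceil> - real l\<bar>
        * real ((n - k) choose l) * real (k choose (r - l))) / real k"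
proof -
  let ?E = "complete_uniform_edges V r"
  let ?X = "unbalancedness V ?E f"
  \<comment> \<open>This is the floor of \<open>r / 2\<close>. For an edge,
    \<open>card (A \<inter> T) = r - card (A - T)\<close>, so subtracting \<open>c\<close> leaves
    \<open>\<lceil>real r / 2\<rceil> - card (A - T)\<close>, whose absolute value is the weight in
    the claimed bound with \<open>l = card (A - T)\<close>.\<close>
  define c where "c = int r - \<lceil>real r / 2\<rceil>"
  define d where "d v = (\<Sum>A\<in>{A \<in> ?E. v \<in> A}. f A)" for v
  have finE: "finite ?E"
    using \<open>finite V\<close> by (simp add: complete_uniform_edges_def)
  \<comment> \<open>Rounding \<open>n / 2\<close> up adds at most one half, which is the slack that
    the pigeonhole step allows. Positivity of \<open>k\<close> justifies the final division.\<close>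
  have k0: "0 < k" and "2 * k \<le> card V + 1"
    using assms by linarith+
  have "?X \<le> \<bar>d v\<bar>" if "v \<in> V" for v
    using that \<open>finite V\<close> by (auto simp: unbalancedness_def d_def intro!: Min_le)
  then obtain T where T: "T \<subseteq> V" "card T = k" "int k * ?X \<le> \<bar>\<Sum>v\<in>T. d v\<bar>"
    using exists_same_sign_subset \<open>finite V\<close> \<open>2 * k \<le> card V + 1\<close> by metis
  have finT: "finite T"
    using T(1) \<open>finite V\<close> finite_subset by blast
  have "int k * ?X \<le> (\<Sum>A\<in>?E. \<bar>int (card (A \<inter> T)) - c\<bar>)"
    using T(3) abs_sum_signed_degrees_le[OF finE finT f, of c] by (simp add: d_def)
  then have "real k * real_of_int ?X \<le> real_of_int (\<Sum>A\<in>?E. \<bar>int (card (A \<inter> T)) - c\<bar>)"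
    by (metis of_int_le_iff of_int_mult of_int_of_nat_eq)
  also have "\<dots> = (\<Sum>A\<in>?E. \<bar>real_of_int \<lceil>real r / 2\<rceil> - real (card (A - T))\<bar>)"
    unfolding of_int_sum
  proof (intro sum.cong refl)
    fix A assume "A \<in> ?E"
    then have "finite A" "card A = r"
      using \<open>finite V\<close> finite_subset by (auto simp: complete_uniform_edges_def)
    then have "card (A \<inter> T) + card (A - T) = r"
      using card_Int_Diff by metis
    then show "real_of_int \<bar>int (card (A \<inter> T)) - c\<bar>
        = \<bar>real_of_int \<lceil>real r / 2\<rceil> - real (card (A - T))\<bar>"
      by (auto simp: c_def)
  qed
  also have "\<dots> = (\<Sum>l=0..r. \<bar>real_of_int \<lceil>real r / 2\<rceil> - real l\<bar>
        * real ((n - k) choose l) * real (k choose (r - l)))"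
    using T assms(2) finT \<open>finite V\<close>
    by (subst sum_over_complete_uniform_edges) (simp_all add: card_Diff_subset)
  finally show ?thesis
    using k0 by (simp add: pos_le_divide_eq mult.commute)
qed

theorem theorem1p1:
  fixes V :: "'a set" and E :: "'a set set" and n r k :: nat and B :: real
  assumes "finite V" and "card V = n"
    and "1 \<le> r" and "r \<le> n"
    and "E = complete_uniform_edges V r"
    and "k = nat \<lceil>real n / 2\<rceil>"
    and "B = (\<Sum>l=0..r. \<bar>real_of_int \<lceil>real r / 2\<rceil> - real l\<bar>
                 * real ((n - k) choose l) * real (k choose (r - l))) / real k"
  shows "(\<forall>f. f \<in> E \<rightarrow> {-1, 1} \<longrightarrow> (\<Sum>A\<in>E. f A) = 0
            \<longrightarrow> real_of_int (unbalancedness V E f) \<le> B)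
       \<and> (balanced_signings E \<noteq> {}
            \<longrightarrow> real_of_int (hypergraph_unbalancedness V E) \<le> B)"
proof -
  have le: "real_of_int (unbalancedness V E f) \<le> B"
    if "f \<in> E \<rightarrow> {-1, 1}" "(\<Sum>A\<in>E. f A) = 0" for f
    using unbalancedness_complete_le[of V n k f r] assms that by simp
  have "finite E"
    using assms(1,5) by (simp add: complete_uniform_edges_def)
  then have "finite (E \<rightarrow>\<^sub>E {-1, 1 :: int})"
    by (intro finite_PiE) auto
  then have fin: "finite (balanced_signings E)"
    by (simp add: balanced_signings_def)
  have "real_of_int (hypergraph_unbalancedness V E) \<le> B" if "balanced_signings E \<noteq> {}"
  proof -
    \<comment> \<open>The maximum over a finite nonempty set is attained, so it is the
      unbalancedness of some balanced signing, to which \<open>le\<close> applies.\<close>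
    have "hypergraph_unbalancedness V E \<in> unbalancedness V E ` balanced_signings E"
      unfolding hypergraph_unbalancedness_def using fin that by (intro Max_in) auto
    then show ?thesis
      using le by (auto simp: balanced_signings_def PiE_def)
  qed
  with le show ?thesis by blast
qed

end
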